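(* Let $(\mathbb{S},\oplus,\otimes,\mathbb{0},\mathbb{1},\leq_{\mathbb{S}})$ be a totally ordered idempotent semiring and let $\mathcal{P}\subset\mathbb{S}^n$ be the solution set of the system $A\mathbf{x}\oplus\mathbf{c}\leq_{\mathbb{S}}B\mathbf{x}\oplus\mathbf{d}$, where $A,B\in\mathbb{S}^{p\times n}$ and $\mathbf{c},\mathbf{d}\in\mathbb{S}^p$ satisfy the following conditions: (i) $A_{in}$ is (left-)invertible with respect to $\otimes$ if $A_{in}\neq\mathbb{0}$ (its inverse is denoted by $A_{in}^{-1}$); (ii) for any $\alpha\in\mathbb{S}$ there exists $\beta\in\mathbb{S}$ such that $\alpha\leq_{\mathbb{S}}B_{in}\beta$ if $B_{in}\neq\mathbb{0}$; (iii) either $A_{ij}=\mathbb{0}$ or $B_{ij}=\mathbb{0}$, for $i\in\{1,\dots,p\}$ and $j\in\{1,\dots,n\}$. Let $\mathcal{Q}\subset\mathbb{S}^{n-1}$ be the set defined by the following inequalities in the variables $\mathbf{x}_1,\dots,\mathbf{x}_{n-1}$: $$\Big(\bigoplus_{j\neq n}A_{ij}\mathbf{x}_j\Big)\oplus\mathbf{c}_i\leq_{\mathbb{S}}\Big(\bigoplus_{j\neq n}B_{ij}\mathbf{x}_j\Big)\oplus\mathbf{d}_i$$ for all $i\in\{1,\dots,p\}$ such that $B_{in}=\mathbb{0}$, and $$\Big(\bigoplus_{j\neq n}A_{ij}\mathbf{x}_j\Big)\oplus\mathbf{c}_i\leq_{\mathbb{S}}\Big(\bigoplus_{j\neq n}(B_{ij}\oplus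 B_{in}A_{kn}^{-1}B_{kj})\mathbf{x}_j\Big)\oplus\mathbf{d}_i\oplus B_{in}A_{kn}^{-1}\mathbf{d}_k$$ for all $i,k\in\{1,\dots,p\}$ such that $B_{in}\neq\mathbb{0}$ and $A_{kn}\neq\mathbb{0}$. Then $\mathbf{x}\in\mathcal{Q}$ if, and only if, there exists $\lambda\in\mathbb{S}$ such that $(\mathbf{x},\lambda)\in\mathcal{P}$.
   Context: A semiring $(\mathbb{S},\oplus,\otimes,\mathbb{0},\mathbb{1})$ (multiplication $\otimes$ is also written as concatenation) is totally ordered if there is a total order $\leq_{\mathbb{S}}$ on $\mathbb{S}$ such that $\mathbb{0}\leq_{\mathbb{S}}a$ for all $a\in\mathbb{S}$, and for all $a,b,c\in\mathbb{S}$, $a\leq_{\mathbb{S}}b$ implies $a\oplus c\leq_{\mathbb{S}}b\oplus c$, $a\otimes c\leq_{\mathbb{S}}b\otimes c$ and $c\otimes a\leq_{\mathbb{S}}c\otimes b$. It is idempotent if $a\oplus a=a$ for all $a\in\mathbb{S}$. An element $a$ is left-invertible if there is an element $a^{-1}\in\mathbb{S}$ with $a^{-1}\otimes a=\mathbb{1}$. Here $M_{in}$ denotes the $(i,n)$-entry of a matrix $M$ (with $n$ the index of the eliminated variable $\mathbf{x}_n$). Matrix-vector operations are the usual ones with $\oplus,\otimes$ (so $(A\mathbf{x})_i=\bigoplus_jA_{ij}\otimes\mathbf{x}_j$), and vector inequalities are entrywise.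
   Formalization: Condition (i) is taken with two-sided inverses (both products of A_in and its inverse equal 1); with only a left inverse the claim fails in some non-commutative semirings (bicyclic monoid), while for commutative multiplication the two conditions agree. *)

theory Defs
  imports "Jordan_Normal_Form.Matrix"
begin

(* The premise 0 <= c in the two monotonicity axioms of multiplication inherited from
   ordered_semiring is vacuous because of zero_least. Multiplication need not commute,
   and 0 = 1 is not excluded. *)
class totally_ordered_idempotent_semiring = linorder + ordered_semiring_0 + monoid_mult +
  assumes zero_least: "0 \<le> a"
    and add_idempotent: "a + a = a"

definition left_inverse :: "'a::monoid_mult \<Rightarrow> 'a \<Rightarrow> bool" where
  "left_inverse b a \<longleftrightarrow> b * a = 1"

(* A left inverse alone does not suffice for Fourier-Motzkin elimination: if b * a = 1 but
   a * b > 1, then the system a * x <= 1, b <= x has no solution, although eliminating x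
   from it leaves only 0 <= 1 and b <= b. Hence invertible means two-sided here; when multiplication
   commutes this is the same as left-invertible. *)
definition is_inverse :: "'a::monoid_mult \<Rightarrow> 'a \<Rightarrow> bool" where
  "is_inverse b a \<longleftrightarrow> left_inverse b a \<and> left_inverse a b"

definition mult_invertible :: "'a::monoid_mult \<Rightarrow> bool" where
  "mult_invertible a \<longleftrightarrow> (\<exists>b. is_inverse b a)"

definition mult_inverse :: "'a::monoid_mult \<Rightarrow> 'a" where
  "mult_inverse a = (THE b. is_inverse b a)"

definition solution_set ::
  "'a::totally_ordered_idempotent_semiring mat \<Rightarrow> 'a mat \<Rightarrow> 'a vec \<Rightarrow> 'a vec \<Rightarrow> 'a vec set" where
  "solution_set A B c d = {x \<in> carrier_vec (dim_col A). A *\<^sub>v x + c \<le> B *\<^sub>v x + d}"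

(* Indices start at 0, so the eliminated last variable has index n - 1 for n = dim_col A,
   and the remaining ones have the indices j < n - 1. *)
definition eliminated_set ::
  "'a::totally_ordered_idempotent_semiring mat \<Rightarrow> 'a mat \<Rightarrow> 'a vec \<Rightarrow> 'a vec \<Rightarrow> 'a vec set" where
  "eliminated_set A B c d =
    (let p = dim_row A; l = dim_col A - 1 in
     {x \<in> carrier_vec l.
        (\<forall>i<p. B $$ (i, l) = 0 \<longrightarrow>
           (\<Sum>j<l. A $$ (i, j) * x $ j) + c $ i \<le> (\<Sum>j<l. B $$ (i, j) * x $ j) + d $ i) \<and>
        (\<forall>i<p. \<forall>k<p. B $$ (i, l) \<noteq> 0 \<and> A $$ (k, l) \<noteq> 0 \<longrightarrow>
           (\<Sum>j<l. A $$ (i, j) * x $ j) + c $ i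
           \<le> (\<Sum>j<l. (B $$ (i, j) + B $$ (i, l) * mult_inverse (A $$ (k, l)) * B $$ (k, j)) * x $ j)
              + d $ i + B $$ (i, l) * mult_inverse (A $$ (k, l)) * d $ k)})"

end

(* Since the semiring is idempotent and 0 is least, addition is the maximum. The rows of the
   system then say L i \<le> max (R i) (b i * \<mu>) if b i \<noteq> 0, and L i \<le> R i together with
   the upper bound \<mu> \<le> inverse (a i) * R i otherwise, where L and R do not involve \<mu>.
   So \<mu> may be taken as the least of the upper bounds, or arbitrarily large if there are none. *)
theory Submission
  imports Defs
begin

text \<open>A left and a right inverse of the same element coincide by associativity; this makes the
  definite description in \<open>mult_inverse\<close> well defined.\<close>

lemma is_inverse_unique:
  assumes "is_inverse b a" and "is_inverse b' a"
  shows "b = b'"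
proof -
  have "b = b * (a * b')" using assms(2) by (simp add: is_inverse_def left_inverse_def)
  also have "\<dots> = b'" using assms(1)
    by (simp add: is_inverse_def left_inverse_def flip: mult.assoc)
  finally show ?thesis .
qed

lemma is_inverse_mult_inverse:
  assumes "mult_invertible a"
  shows "is_inverse (mult_inverse a) a"
proof -
  from assms obtain b where "is_inverse b a" by (auto simp: mult_invertible_def)
  then show ?thesis unfolding mult_inverse_def
    by (rule theI) (metis is_inverse_unique \<open>is_inverse b a\<close>)
qed

lemma mult_inverse_cancel:
  assumes "mult_invertible a"
  shows "mult_inverse a * (a * y) = y" and "a * (mult_inverse a * y) = y"
  using is_inverse_mult_inverse[OF assms]
  by (simp_all add: is_inverse_def left_inverse_def flip: mult.assoc)

context totally_ordered_idempotent_semiring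
begin

text \<open>If \<open>a \<le> b\<close>, monotonicity and idempotence give
  \<open>a + b \<le> b + b = b\<close>, while \<open>0 \<le> a\<close> gives
  \<open>b \<le> a + b\<close>; the other case is symmetric.\<close>

lemma add_eq_max: "a + b = max a b"
proof (cases "a \<le> b")
  case True
  have "a + b = b"
  proof (rule order.antisym)
    show "a + b \<le> b" using add_right_mono[OF True, of b] by (simp add: add_idempotent)
    show "b \<le> a + b" using add_right_mono[OF zero_least, of b a] by simp
  qed
  with True show ?thesis by (simp add: max_def)
next
  case False
  then have "b \<le> a" by simp
  have "a + b = a"
  proof (rule order.antisym)
    show "a + b \<le> a" using add_left_mono[OF \<open>b \<le> a\<close>, of a] by (simp add: add_idempotent)
    show "a \<le> a + b" using add_left_mono[OF zero_least, of a b] by simp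
  qed
  with False show ?thesis by (simp add: max_def)
qed

lemma mult_mono_left: "b \<le> c \<Longrightarrow> a * b \<le> a * c"
  by (rule mult_left_mono[OF _ zero_least])

end

text \<open>Left multiplications by \<open>a\<close> and by its inverse are monotone and undo each
  other. One direction uses that the inverse is a right inverse, the other that it is a left
  inverse.\<close>

lemma le_mult_inverse_iff:
  fixes a y z :: "'a::totally_ordered_idempotent_semiring"
  assumes "mult_invertible a"
  shows "z \<le> mult_inverse a * y \<longleftrightarrow> a * z \<le> y"
  using mult_mono_left[of z "mult_inverse a * y" a]
    mult_mono_left[of "a * z" y "mult_inverse a"] mult_inverse_cancel[OF assms]
  by auto

text \<open>With the retained variables fixed, every row is an inequality in the single unknown
  \<open>\<mu>\<close>, so the elimination reduces to this scalar statement.\<close>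

lemma fourier_motzkin:
  fixes a b L R :: "nat \<Rightarrow> 'a::totally_ordered_idempotent_semiring"
  assumes inv: "\<And>i. i < p \<Longrightarrow> a i \<noteq> 0 \<Longrightarrow> mult_invertible (a i)"
    and unbounded: "\<And>i \<alpha>. i < p \<Longrightarrow> b i \<noteq> 0 \<Longrightarrow> \<exists>\<beta>. \<alpha> \<le> b i * \<beta>"
    and disj: "\<And>i. i < p \<Longrightarrow> a i = 0 \<or> b i = 0"
  shows "(\<exists>\<mu>. \<forall>i<p. L i + a i * \<mu> \<le> R i + b i * \<mu>) \<longleftrightarrow>
    (\<forall>i<p. b i = 0 \<longrightarrow> L i \<le> R i) \<and>
    (\<forall>i<p. \<forall>k<p. b i \<noteq> 0 \<and> a k \<noteq> 0 \<longrightarrow> L i \<le> R i + b i * mult_inverse (a k) * R k)"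
    (is "_ = (?P \<and> ?Q)")
proof
  assume "\<exists>\<mu>. \<forall>i<p. L i + a i * \<mu> \<le> R i + b i * \<mu>"
  then obtain \<mu> where \<mu>: "\<And>i. i < p \<Longrightarrow> L i + a i * \<mu> \<le> R i + b i * \<mu>" by blast
  have ?P
  proof (intro allI impI)
    fix i assume "i < p" and "b i = 0"
    then show "L i \<le> R i" using \<mu>[of i] by (simp add: add_eq_max max_absorb1 zero_least)
  qed
  moreover have ?Q
  proof (intro allI impI)
    fix i k assume i: "i < p" and k: "k < p" and nz: "b i \<noteq> 0 \<and> a k \<noteq> 0"
    \<comment> \<open>Row \<open>k\<close> thus bounds \<open>\<mu>\<close> from above; by
      monotonicity this bound may replace \<open>\<mu>\<close> in row \<open>i\<close>.\<close>
    have "b k = 0" using disj[OF k] nz by simp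
    then have "a k * \<mu> \<le> R k" using \<mu>[OF k] by (simp add: add_eq_max max_absorb1 zero_least)
    then have "\<mu> \<le> mult_inverse (a k) * R k" using inv[OF k] nz by (simp add: le_mult_inverse_iff)
    then have "b i * \<mu> \<le> b i * mult_inverse (a k) * R k" by (simp add: mult_mono_left mult.assoc)
    moreover have "L i \<le> max (R i) (b i * \<mu>)" using \<mu>[OF i] by (simp add: add_eq_max)
    ultimately show "L i \<le> R i + b i * mult_inverse (a k) * R k"
      by (auto simp: add_eq_max le_max_iff_disj)
  qed
  ultimately show "?P \<and> ?Q" ..
next
  assume PQ: "?P \<and> ?Q"
  define K where "K = {k. k < p \<and> a k \<noteq> 0}"
  have "finite K" by (simp add: K_def)
  \<comment> \<open>By \<open>disj\<close> no row has both coefficients nonzero, so these two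
    properties and \<open>?P\<close> together settle every row.\<close>
  obtain \<mu> where upper: "\<And>k. k \<in> K \<Longrightarrow> \<mu> \<le> mult_inverse (a k) * R k"
    and lower: "\<And>i. i < p \<Longrightarrow> b i \<noteq> 0 \<Longrightarrow> L i \<le> R i + b i * \<mu>"
  proof (cases "K = {}")
    case True
    have "\<forall>i. \<exists>\<beta>. i < p \<longrightarrow> b i \<noteq> 0 \<longrightarrow> L i \<le> b i * \<beta>" using unbounded by blast
    then obtain \<beta> where \<beta>: "\<And>i. i < p \<Longrightarrow> b i \<noteq> 0 \<Longrightarrow> L i \<le> b i * \<beta> i"
      by metis
    \<comment> \<open>Inserting 0 keeps the set nonempty when \<open>p = 0\<close>.\<close>
    define \<mu> where "\<mu> = Max (insert 0 (\<beta> ` {..<p}))"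
    show thesis
    proof (rule that[of \<mu>])
      fix i assume i: "i < p" and nz: "b i \<noteq> 0"
      have "\<beta> i \<le> \<mu>" unfolding \<mu>_def using i by (intro Max_ge) auto
      then have "b i * \<beta> i \<le> b i * \<mu>" by (rule mult_mono_left)
      with \<beta>[OF i nz] show "L i \<le> R i + b i * \<mu>"
        by (auto simp: add_eq_max le_max_iff_disj)
    qed (use True in simp)
  next
    case False
    let ?U = "(\<lambda>k. mult_inverse (a k) * R k) ` K"
    \<comment> \<open>The minimum is attained at some \<open>k\<close>, so the lower condition for
      row \<open>i\<close> is exactly the instance of \<open>?Q\<close> for the pair
      \<open>i\<close>, \<open>k\<close>.\<close>
    have "Min ?U \<in> ?U" using \<open>finite K\<close> False by (intro Min_in) auto
    then obtain k where k: "k < p" "a k \<noteq> 0" "Min ?U = mult_inverse (a k) * R k"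
      by (auto simp: K_def)
    show thesis
    proof (rule that[of "Min ?U"])
      show "Min ?U \<le> mult_inverse (a k) * R k" if "k \<in> K" for k
        using that \<open>finite K\<close> by (intro Min_le) auto
      show "L i \<le> R i + b i * Min ?U" if "i < p" "b i \<noteq> 0" for i
        using PQ that k(1,2) unfolding k(3) by (simp add: mult.assoc)
    qed
  qed
  have "L i + a i * \<mu> \<le> R i + b i * \<mu>" if i: "i < p" for i
  proof (cases "b i = 0")
    case True
    moreover have "a i * \<mu> \<le> R i"
    proof (cases "a i = 0")
      case False
      then show ?thesis using upper[of i] inv[OF i] i by (simp add: K_def le_mult_inverse_iff)
    qed (simp add: zero_least)
    ultimately show ?thesis using PQ i by (simp add: add_eq_max max_absorb1 zero_least)
  next
    case False
    then show ?thesis using lower[OF i] disj[OF i] by auto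
  qed
  then show "\<exists>\<mu>. \<forall>i<p. L i + a i * \<mu> \<le> R i + b i * \<mu>" by blast
qed

lemma mult_mat_vec_append_last:
  fixes M :: "'a::semiring_0 mat"
  assumes "M \<in> carrier_mat p (Suc l)" and "x \<in> carrier_vec l" and "i < p"
  shows "(M *\<^sub>v (x @\<^sub>v vec 1 (\<lambda>_. \<mu>))) $ i = (\<Sum>j<l. M $$ (i, j) * x $ j) + M $$ (i, l) * \<mu>"
proof -
  have "(M *\<^sub>v (x @\<^sub>v vec 1 (\<lambda>_. \<mu>))) $ i
      = (\<Sum>j<Suc l. M $$ (i, j) * (x @\<^sub>v vec 1 (\<lambda>_. \<mu>)) $ j)"
    using assms by (auto simp: scalar_prod_def lessThan_atLeast0 intro!: sum.cong)
  also have "\<dots> = (\<Sum>j<l. M $$ (i, j) * x $ j) + M $$ (i, l) * \<mu>"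
    using assms by auto
  finally show ?thesis .
qed

theorem theorem10:
  fixes A B :: "'a::totally_ordered_idempotent_semiring mat"
    and c d x :: "'a vec"
    and n p :: nat
  assumes "n \<ge> 1"
    and "A \<in> carrier_mat p n" and "B \<in> carrier_mat p n"
    and "c \<in> carrier_vec p" and "d \<in> carrier_vec p"
    and "\<And>i. i < p \<Longrightarrow> A $$ (i, n - 1) \<noteq> 0 \<Longrightarrow> mult_invertible (A $$ (i, n - 1))"
    and "\<And>i \<alpha>. i < p \<Longrightarrow> B $$ (i, n - 1) \<noteq> 0 \<Longrightarrow> \<exists>\<beta>. \<alpha> \<le> B $$ (i, n - 1) * \<beta>"
    and "\<And>i j. i < p \<Longrightarrow> j < n \<Longrightarrow> A $$ (i, j) = 0 \<or> B $$ (i, j) = 0"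
    and "x \<in> carrier_vec (n - 1)"
  shows "x \<in> eliminated_set A B c d \<longleftrightarrow>
    (\<exists>\<mu>. x @\<^sub>v vec 1 (\<lambda>_. \<mu>) \<in> solution_set A B c d)"
proof -
  obtain l where n: "n = Suc l" using assms(1) by (cases n) auto
  have A: "A \<in> carrier_mat p (Suc l)" and B: "B \<in> carrier_mat p (Suc l)"
    and x: "x \<in> carrier_vec l"
    using assms n by auto
  let ?a = "\<lambda>i. A $$ (i, l)" and ?b = "\<lambda>i. B $$ (i, l)"
  define L where "L i = (\<Sum>j<l. A $$ (i, j) * x $ j) + c $ i" for i
  define R where "R i = (\<Sum>j<l. B $$ (i, j) * x $ j) + d $ i" for i
  have xv: "x @\<^sub>v vec 1 (\<lambda>_. \<mu>) \<in> carrier_vec (Suc l)" for \<mu>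
    using x by (auto intro!: carrier_vecI)
  \<comment> \<open>The deleted simp rules would unfold the product entries and rewrite
    \<open>vec 1\<close> before the splitting lemma could match.\<close>
  have sol: "x @\<^sub>v vec 1 (\<lambda>_. \<mu>) \<in> solution_set A B c d \<longleftrightarrow>
      (\<forall>i<p. L i + ?a i * \<mu> \<le> R i + ?b i * \<mu>)" for \<mu>
    using A B xv[of \<mu>] assms(4,5)
    by (auto simp: solution_set_def less_eq_vec_def L_def R_def add.assoc
        add.commute[of "c $ _"] add.commute[of "d $ _"]
        mult_mat_vec_append_last[OF A x] mult_mat_vec_append_last[OF B x]
        simp del: index_mult_mat_vec One_nat_def)
  \<comment> \<open>Here \<open>t\<close> stands for \<open>?b i * mult_inverse (?a k)\<close>: the
    combined row is row \<open>i\<close> plus a left multiple of row \<open>k\<close>.\<close>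
  have combined: "(\<Sum>j<l. (B $$ (i, j) + t * B $$ (k, j)) * x $ j) + d $ i + t * d $ k
      = R i + t * R k" for i k t
    by (simp add: R_def distrib_left distrib_right sum.distrib sum_distrib_left ac_simps)
  have elim: "x \<in> eliminated_set A B c d \<longleftrightarrow>
      (\<forall>i<p. ?b i = 0 \<longrightarrow> L i \<le> R i) \<and>
      (\<forall>i<p. \<forall>k<p. ?b i \<noteq> 0 \<and> ?a k \<noteq> 0 \<longrightarrow> L i \<le> R i + ?b i * mult_inverse (?a k) * R k)"
    using A x by (simp add: eliminated_set_def Let_def combined flip: L_def R_def)
  show ?thesis
    unfolding sol elim
    by (rule fourier_motzkin[symmetric]) (use assms(6-8) n in auto)
qed

end
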